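(* For $n\geq1$ and $0\leq k\leq n-1$, $$\bigl|\{e\in\mathbf{I}_n(\geq,-,>): e_n=k\}\bigr|=\bigl|\{e\in\mathbf{I}_n(021): e_n\equiv k+1 \pmod n\}\bigr|.$$ (Since $0\leq e_n\leq n-1$, the right-hand condition means $e_n=k+1$ if $k\leq n-2$ and $e_n=0$ if $k=n-1$.)
   Context: $\mathbf{I}_n=\{(e_1,\ldots,e_n): 0\leq e_i<i\}$ is the set of inversion sequences of length $n$. $\mathbf{I}_n(\geq,-,>)$ is the set of $e\in\mathbf{I}_n$ with no indices $i<j<k$ such that $e_i\geq e_j$ and $e_i>e_k$. $\mathbf{I}_n(021)$ is the set of $e\in\mathbf{I}_n$ with no indices $i<j<k$ such that $e_i<e_k<e_j$ (equivalently, the positive entries of $e$ are weakly increasing). *)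

theory Defs
  imports "HOL-Number_Theory.Cong"
begin

text \<open>Sequences are lists indexed from 0, so the entry written $e_i$ ($1 \le i \le n$) is
  \<open>e ! (i - 1)\<close>, and the bound $0 \le e_i < i$ becomes \<open>e ! i < i + 1\<close> for \<open>i < n\<close>.\<close>

definition inv_seqs :: "nat \<Rightarrow> nat list set" where
  "inv_seqs n = {e. length e = n \<and> (\<forall>i<n. e ! i < i + 1)}"

definition inv_seqs_ge_gt :: "nat \<Rightarrow> nat list set" where
  "inv_seqs_ge_gt n = {e \<in> inv_seqs n.
     \<not> (\<exists>i j k. i < j \<and> j < k \<and> k < n \<and> e ! i \<ge> e ! j \<and> e ! i > e ! k)}"

definition inv_seqs_021 :: "nat \<Rightarrow> nat list set" where
  "inv_seqs_021 n = {e \<in> inv_seqs n.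
     \<not> (\<exists>i j k. i < j \<and> j < k \<and> k < n \<and> e ! i < e ! k \<and> e ! k < e ! j)}"

end

theory Submission
  imports Defs
begin

text \<open>Removing the last entry turns the left-hand side into the number of
  \<open>(\<ge>,-,>)\<close>-avoiders \<open>e\<close> of length \<open>n - 1\<close> in which every entry above \<open>k\<close> is smaller than all
  later ones, and the right-hand side into the number \<open>P (n - 1) (k + 1)\<close> of \<open>021\<close>-avoiders of
  length \<open>n - 1\<close> with entries at most \<open>k + 1\<close>. Splitting by the last entry gives
  \<open>P n m + P (n - 1) (m - 1) = P n (m - 1) + 2 * P (n - 1) m\<close>. On the other side, \<open>e\<close> is an avoider
  with entries at most \<open>k\<close> followed by a strictly increasing run above \<open>k\<close>. Counting the runs by
  Pascal's rule expresses the cardinality as a binomial transform of the numbers \<open>U n k\<close> of avoiders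
  with entries at most \<open>k\<close>, and \<open>U n k = U n (k - 1) + U (n - 1) k + U (n - 1) (k - 1)\<close> is carried by
  this transform to the recurrence of \<open>P\<close>.\<close>

text \<open>This is the condition on a prefix under which \<open>k\<close> can be appended without
  creating a forbidden pattern.\<close>

definition incr_above :: "nat \<Rightarrow> nat list \<Rightarrow> bool" where
  "incr_above k e \<longleftrightarrow> (\<forall>i j. i < j \<and> j < length e \<and> k < e ! i \<longrightarrow> e ! i < e ! j)"

definition bounded_021 :: "nat \<Rightarrow> nat \<Rightarrow> nat list set" where
  "bounded_021 n m = {e \<in> inv_seqs_021 n. \<forall>x\<in>set e. x \<le> m}"

definition bounded_ge_gt :: "nat \<Rightarrow> nat \<Rightarrow> nat list set" where
  "bounded_ge_gt n m = {e \<in> inv_seqs_ge_gt n. \<forall>x\<in>set e. x \<le> m}"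

text \<open>The slack \<open>j\<close> is the second index of the binomial transform:
  the cardinality is \<open>\<Sum>i. (r choose i) * U (k + 1 + j + i) k\<close>.\<close>

definition shifted_ge_gt :: "nat \<Rightarrow> nat \<Rightarrow> nat \<Rightarrow> nat list set" where
  "shifted_ge_gt k r j = {e \<in> inv_seqs_ge_gt (k + 1 + j + r). incr_above k e \<and>
     (\<forall>i < length e. k < e ! i \<longrightarrow> e ! i + j \<le> i)}"

section \<open>Finiteness and bounds on entries\<close>

lemma finite_inv_seqs: "finite (inv_seqs n)"
proof (rule finite_subset)
  show "inv_seqs n \<subseteq> {e. set e \<subseteq> {..n} \<and> length e = n}"
    by (fastforce simp: inv_seqs_def in_set_conv_nth)
qed (simp add: finite_lists_length_eq)

lemma finite_inv_seqs_ge_gt: "finite (inv_seqs_ge_gt n)"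
  using finite_inv_seqs[of n] by (rule rev_finite_subset) (auto simp: inv_seqs_ge_gt_def)

lemma finite_bounded_ge_gt: "finite (bounded_ge_gt n m)"
  using finite_inv_seqs_ge_gt[of n] by (simp add: bounded_ge_gt_def)

lemma finite_shifted_ge_gt: "finite (shifted_ge_gt k r j)"
  using finite_inv_seqs_ge_gt by (simp add: shifted_ge_gt_def)

lemma finite_bounded_021: "finite (bounded_021 n m)"
  using finite_inv_seqs[of n]
  by (rule rev_finite_subset) (auto simp: inv_seqs_021_def bounded_021_def)

lemma length_ge_gt: "e \<in> inv_seqs_ge_gt n \<Longrightarrow> length e = n"
  by (simp add: inv_seqs_ge_gt_def inv_seqs_def)

lemma nth_ge_gt: "e \<in> inv_seqs_ge_gt n \<Longrightarrow> i < n \<Longrightarrow> e ! i \<le> i"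
  by (force simp: inv_seqs_ge_gt_def inv_seqs_def)

lemma set_ge_gt: "e \<in> inv_seqs_ge_gt n \<Longrightarrow> x \<in> set e \<Longrightarrow> x < n"
  by (metis in_set_conv_nth le_less_trans length_ge_gt nth_ge_gt)

lemma length_021: "e \<in> inv_seqs_021 n \<Longrightarrow> length e = n"
  by (simp add: inv_seqs_021_def inv_seqs_def)

lemma nth_021: "e \<in> inv_seqs_021 n \<Longrightarrow> i < n \<Longrightarrow> e ! i \<le> i"
  by (force simp: inv_seqs_021_def inv_seqs_def)

lemma set_021: "e \<in> inv_seqs_021 n \<Longrightarrow> x \<in> set e \<Longrightarrow> x < n"
  by (metis in_set_conv_nth le_less_trans length_021 nth_021)

section \<open>Appending a last entry\<close>

lemma inv_seqs_snoc: "e @ [v] \<in> inv_seqs (Suc n) \<longleftrightarrow> e \<in> inv_seqs n \<and> v \<le> n"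
  by (auto simp: inv_seqs_def nth_append All_less_Suc)

lemma ge_gt_0: "inv_seqs_ge_gt 0 = {[]}"
  by (auto simp: inv_seqs_ge_gt_def inv_seqs_def)

lemma inv_seqs_021_0: "inv_seqs_021 0 = {[]}"
  by (auto simp: inv_seqs_021_def inv_seqs_def)

lemma incr_above_snoc:
  "incr_above k (e @ [v]) \<longleftrightarrow> incr_above k e \<and> (\<forall>x\<in>set e. k < x \<longrightarrow> x < v)"
proof
  assume *: "incr_above k (e @ [v])"
  have "e ! i < e ! j" if "i < j" "j < length e" "k < e ! i" for i j
    using *[unfolded incr_above_def, rule_format, of i j] that by (simp add: nth_append)
  moreover have "e ! i < v" if "i < length e" "k < e ! i" for i
    using *[unfolded incr_above_def, rule_format, of i "length e"] that by (simp add: nth_append)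
  ultimately show "incr_above k e \<and> (\<forall>x\<in>set e. k < x \<longrightarrow> x < v)"
    by (auto simp: incr_above_def in_set_conv_nth)
next
  assume "incr_above k e \<and> (\<forall>x\<in>set e. k < x \<longrightarrow> x < v)"
  then show "incr_above k (e @ [v])"
    by (auto simp: incr_above_def nth_append less_Suc_eq)
qed

lemma incr_above_mono: "incr_above k e \<Longrightarrow> k \<le> l \<Longrightarrow> incr_above l e"
  by (auto simp: incr_above_def)

lemma incr_above_trivial: "\<forall>x\<in>set e. x \<le> k \<Longrightarrow> incr_above k e"
  unfolding incr_above_def by (meson leD less_trans nth_mem)

text \<open>From position \<open>i\<close> on, all entries stay above \<open>k\<close>, so each step
  gains at least one.\<close>

lemma incr_above_gap:
  assumes "incr_above k e" "i \<le> m" "m < length e" "k < e ! i"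
  shows "e ! i + (m - i) \<le> e ! m"
  using assms(2,3)
proof (induction m rule: dec_induct)
  case (step m)
  have "k < e ! m" using step assms(4) by simp
  then have "e ! m < e ! Suc m" using assms(1) step by (simp add: incr_above_def)
  with step show ?case by simp
qed simp

text \<open>A new pattern must end in \<open>v\<close>; its first two entries then form a weak
  descent starting above \<open>v\<close>, which \<open>incr_above v\<close> rules out.\<close>

lemma ge_gt_snoc:
  "e @ [v] \<in> inv_seqs_ge_gt (Suc n) \<longleftrightarrow> e \<in> inv_seqs_ge_gt n \<and> v \<le> n \<and> incr_above v e"
proof (cases "length e = n")
  case True
  have "(\<exists>i j k. i < j \<and> j < k \<and> k < Suc n \<and> (e@[v]) ! i \<ge> (e@[v]) ! j \<and> (e@[v]) ! i > (e@[v]) ! k)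
     \<longleftrightarrow> (\<exists>i j k. i < j \<and> j < k \<and> k < n \<and> e ! i \<ge> e ! j \<and> e ! i > e ! k) \<or>
         (\<exists>i j. i < j \<and> j < n \<and> e ! i \<ge> e ! j \<and> e ! i > v)" (is "?L \<longleftrightarrow> ?R1 \<or> ?R2")
  proof
    assume ?L
    then obtain i j k where *: "i < j" "j < k" "k < Suc n" "(e@[v]) ! i \<ge> (e@[v]) ! j"
      "(e@[v]) ! i > (e@[v]) ! k" by blast
    show "?R1 \<or> ?R2"
    proof (cases "k = n")
      case True
      with * \<open>length e = n\<close> have ?R2 by (auto simp: nth_append)
      then show ?thesis ..
    next
      case False
      with * \<open>length e = n\<close> have "k < n" "e ! i \<ge> e ! j" "e ! i > e ! k"
        by (auto simp: nth_append)
      with * show ?thesis by blast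
    qed
  next
    assume "?R1 \<or> ?R2"
    then show ?L
    proof
      assume ?R1
      then obtain i j k where "i < j" "j < k" "k < n" "e ! i \<ge> e ! j" "e ! i > e ! k" by blast
      with True show ?L by (intro exI[of _ i] exI[of _ j] exI[of _ k]) (simp add: nth_append)
    next
      assume ?R2
      then obtain i j where "i < j" "j < n" "e ! i \<ge> e ! j" "e ! i > v" by blast
      with True show ?L by (intro exI[of _ i] exI[of _ j] exI[of _ n]) (simp add: nth_append)
    qed
  qed
  then show ?thesis using True
    unfolding inv_seqs_ge_gt_def incr_above_def mem_Collect_eq inv_seqs_snoc
    by (simp only: de_Morgan_disj not_ex) (meson not_le)
qed (auto simp: inv_seqs_ge_gt_def inv_seqs_def)

text \<open>The first entry is 0, so a positive \<open>v\<close> after a larger \<open>x\<close>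
  completes the pattern \<open>0 < v < x\<close>. Conversely, \<open>v = 0\<close> cannot exceed the
  first entry of a pattern.\<close>

lemma inv_seqs_021_snoc:
  "e @ [v] \<in> inv_seqs_021 (Suc n) \<longleftrightarrow>
     e \<in> inv_seqs_021 n \<and> v \<le> n \<and> (v = 0 \<or> (\<forall>x\<in>set e. x \<le> v))" (is "?L \<longleftrightarrow> ?R")
proof
  assume L: ?L
  then have len: "length e = n" and inv: "e \<in> inv_seqs n" "v \<le> n"
    by (simp_all add: inv_seqs_021_def inv_seqs_snoc) (simp add: inv_seqs_def)
  have avoid: "\<not> ((e@[v]) ! i < (e@[v]) ! k \<and> (e@[v]) ! k < (e@[v]) ! j)"
    if "i < j" "j < k" "k < Suc n" for i j k
    using L that unfolding inv_seqs_021_def by blast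
  have "e \<in> inv_seqs_021 n"
    unfolding inv_seqs_021_def
  proof (safe)
    fix i j k assume "i < j" "j < k" "k < n" "e ! i < e ! k" "e ! k < e ! j"
    with avoid[of i j k] len show False by (simp add: nth_append)
  qed fact
  moreover have "x \<le> v" if "x \<in> set e" "v > 0" for x
  proof (rule ccontr)
    assume "\<not> x \<le> v"
    from that obtain j where j: "j < n" "e ! j = x" using len by (auto simp: in_set_conv_nth)
    have "0 < n" using j by simp
    then have e0: "e ! 0 = 0" using inv unfolding inv_seqs_def by fastforce
    with j \<open>\<not> x \<le> v\<close> have "0 < j" by (cases j) auto
    with avoid[of 0 j n] j len e0 that \<open>\<not> x \<le> v\<close> show False by (simp add: nth_append)
  qed
  ultimately show ?R using inv by auto
next
  assume R: ?R
  then have len: "length e = n" by (simp add: length_021)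
  have False if *: "i < j" "j < k" "k < Suc n" "(e@[v]) ! i < (e@[v]) ! k" "(e@[v]) ! k < (e@[v]) ! j"
    for i j k
  proof (cases "k = n")
    case True
    with * len have "e ! i < v" "v < e ! j" by (auto simp: nth_append)
    moreover have "e ! j \<in> set e" using * True len by simp
    ultimately show False using R by fastforce
  next
    case False
    with * len have "k < n" "e ! i < e ! k" "e ! k < e ! j" by (auto simp: nth_append)
    with * R show False unfolding inv_seqs_021_def by blast
  qed
  with R show ?L unfolding inv_seqs_021_def by (auto simp: inv_seqs_snoc)
qed

lemma snoc_cases_length:
  assumes "length e = Suc n" obtains e' v where "e = e' @ [v]" "length e' = n"
  using assms by (cases e rule: rev_cases) auto

lemma card_snoc_image: "card ((\<lambda>e. e @ [v]) ` S) = card S"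
  by (rule card_image) (simp add: inj_on_def)

section \<open>Recurrence for avoiders of \<open>(>=,-,>)\<close> with bounded entries\<close>

lemma bounded_ge_gt_diag: "bounded_ge_gt (Suc n) n = inv_seqs_ge_gt (Suc n)"
  by (auto simp: bounded_ge_gt_def less_Suc_eq_le dest: set_ge_gt)

lemma bounded_021_beyond: "n \<le> Suc m \<Longrightarrow> bounded_021 n m = inv_seqs_021 n"
  by (force simp: bounded_021_def dest: set_021)

text \<open>The value \<open>Suc m\<close> fits only in the last position, so the maximum cannot be
  followed by a smaller entry and the general recurrence loses a term.\<close>

lemma card_bounded_ge_gt_diag:
  "card (bounded_ge_gt (Suc (Suc m)) (Suc m))
     = card (bounded_ge_gt (Suc (Suc m)) m) + card (bounded_ge_gt (Suc m) m)"
proof -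
  let ?A = "bounded_ge_gt (Suc (Suc m)) m"
  let ?B = "(\<lambda>e. e @ [Suc m]) ` bounded_ge_gt (Suc m) m"
  have "bounded_ge_gt (Suc (Suc m)) (Suc m) = ?A \<union> ?B"
  proof (intro equalityI subsetI)
    fix e assume e: "e \<in> bounded_ge_gt (Suc (Suc m)) (Suc m)"
    then have "length e = Suc (Suc m)" by (simp add: bounded_ge_gt_def length_ge_gt)
    then obtain x v where [simp]: "e = x @ [v]" by (rule snoc_cases_length)
    have x: "x \<in> inv_seqs_ge_gt (Suc m)" "v \<le> Suc m"
      using e by (auto simp: bounded_ge_gt_def ge_gt_snoc)
    then have "x \<in> bounded_ge_gt (Suc m) m" by (simp add: bounded_ge_gt_diag)
    with e x show "e \<in> ?A \<union> ?B"
      by (cases "v = Suc m") (auto simp: bounded_ge_gt_def)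
  next
    fix e assume "e \<in> ?A \<union> ?B"
    then show "e \<in> bounded_ge_gt (Suc (Suc m)) (Suc m)"
      by (auto simp: bounded_ge_gt_def ge_gt_snoc le_SucI intro!: incr_above_trivial)
  qed
  moreover have "?A \<inter> ?B = {}" by (auto simp: bounded_ge_gt_def)
  ultimately show ?thesis
    by (simp add: card_Un_disjoint finite_bounded_ge_gt card_snoc_image)
qed

text \<open>In a sequence of maximum \<open>m + 1\<close>, anything placed two or more positions after a maximal
  entry is again maximal. So a smaller last entry is preceded by the only maximal entry.\<close>

lemma card_bounded_ge_gt_Suc:
  assumes "m + 2 \<le> n"
  shows "card (bounded_ge_gt (Suc n) (Suc m))
     = card (bounded_ge_gt (Suc n) m) + card (bounded_ge_gt n (Suc m)) + card (bounded_ge_gt n m)"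
proof -
  \<comment> \<open>\<open>?ins\<close> puts the maximum back before the last entry. The three
    classes are: no maximum, maximum last, maximum only in the penultimate position.\<close>
  let ?ins = "\<lambda>e. butlast e @ [Suc m, last e]"
  let ?A = "bounded_ge_gt (Suc n) m"
  let ?B = "(\<lambda>e. e @ [Suc m]) ` bounded_ge_gt n (Suc m)"
  let ?C = "?ins ` bounded_ge_gt n m"
  obtain l where n: "n = Suc l" using assms by (cases n) auto
  have "bounded_ge_gt (Suc n) (Suc m) = ?A \<union> (?B \<union> ?C)"
  proof (intro equalityI subsetI)
    fix e assume e: "e \<in> bounded_ge_gt (Suc n) (Suc m)"
    then have "length e = Suc n" by (simp add: bounded_ge_gt_def length_ge_gt)
    then obtain y v where [simp]: "e = y @ [v]" and ly: "length y = Suc l"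
      unfolding n by (rule snoc_cases_length)
    from ly obtain x w where yx: "y = x @ [w]" by (rule snoc_cases_length)
    have y: "y \<in> bounded_ge_gt n (Suc m)" "v \<le> Suc m" "incr_above v y"
      using e by (auto simp: bounded_ge_gt_def ge_gt_snoc)
    consider "v = Suc m" | "e \<in> ?A" | "v \<le> m" "Suc m \<in> set y"
      using e y by (auto simp: bounded_ge_gt_def le_Suc_eq)
    then show "e \<in> ?A \<union> (?B \<union> ?C)"
    proof cases
      case 3
      have less: "z < w" if "z \<in> set x" "v < z" for z
        using y that by (simp add: yx incr_above_snoc)
      have w: "w = Suc m"
      proof (rule ccontr)
        assume "w \<noteq> Suc m"
        with 3 have "Suc m < w" using less[of "Suc m"] by (auto simp: yx)
        with y show False by (simp add: yx bounded_ge_gt_def)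
      qed
      have "z \<le> m" if "z \<in> set x" for z
      proof (cases "v < z")
        case True
        with less[OF that] w show ?thesis by simp
      qed (use 3 in simp)
      \<comment> \<open>Deleting the maximum moves \<open>v\<close> one place to the left, which
        tightens its bound; \<open>m + 2 \<le> n\<close> leaves room for this.\<close>
      moreover have "v \<le> l"
        using 3 assms n by simp
      ultimately have "x @ [v] \<in> bounded_ge_gt n m"
        using y 3 n by (auto simp: yx bounded_ge_gt_def ge_gt_snoc incr_above_snoc)
      then have "?ins (x @ [v]) \<in> ?C" by (rule imageI)
      with w show ?thesis by (simp add: yx)
    qed (use y in auto)
  next
    fix e assume "e \<in> ?A \<union> (?B \<union> ?C)"
    then consider "e \<in> ?A" | "e \<in> ?B" | "e \<in> ?C" by blast
    then show "e \<in> bounded_ge_gt (Suc n) (Suc m)"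
    proof cases
      case 2
      then show ?thesis using assms
        by (auto simp: bounded_ge_gt_def ge_gt_snoc intro!: incr_above_trivial)
    next
      case 3
      then obtain y where y: "y \<in> bounded_ge_gt n m" "e = ?ins y" by blast
      then have "length y = Suc l" using n by (simp add: bounded_ge_gt_def length_ge_gt)
      then obtain x v where [simp]: "y = x @ [v]" by (rule snoc_cases_length)
      have "incr_above (Suc m) x" "\<forall>z\<in>set x. z \<le> m"
        using y by (auto simp: bounded_ge_gt_def intro!: incr_above_trivial le_SucI)
      moreover have "x \<in> inv_seqs_ge_gt l" "v \<le> m" "incr_above v x" "v \<le> l"
        using y by (auto simp: bounded_ge_gt_def n ge_gt_snoc)
      ultimately have "(x @ [Suc m]) @ [v] \<in> inv_seqs_ge_gt (Suc (Suc l))"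
        using assms n by (simp add: ge_gt_snoc incr_above_snoc le_imp_less_Suc del: append_assoc)
      then show ?thesis
        using y \<open>\<forall>z\<in>set x. z \<le> m\<close> \<open>v \<le> m\<close> by (auto simp: bounded_ge_gt_def n)
    qed (auto simp: bounded_ge_gt_def)
  qed
  moreover have "?A \<inter> (?B \<union> ?C) = {}" by (auto simp: bounded_ge_gt_def)
  moreover have "?B \<inter> ?C = {}"
  proof -
    have "last e \<le> m" if "e \<in> bounded_ge_gt n m" for e
      using that n last_in_set[of e] by (fastforce simp: bounded_ge_gt_def dest: length_ge_gt)
    then have "e' @ [Suc m] \<noteq> ?ins e" if "e \<in> bounded_ge_gt n m" for e e'
      using that by (metis Suc_n_not_le_n last.simps last_append last_snoc list.distinct(1))
    then show ?thesis by blast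
  qed
  moreover have "card ?C = card (bounded_ge_gt n m)"
  proof (rule card_image, rule inj_onI)
    fix a b assume ab: "a \<in> bounded_ge_gt n m" "b \<in> bounded_ge_gt n m" and eq: "?ins a = ?ins b"
    from ab have "a \<noteq> []" "b \<noteq> []"
      using n by (auto simp: bounded_ge_gt_def dest: length_ge_gt)
    moreover have "butlast a = butlast b" "last a = last b"
      using arg_cong[OF eq, of "\<lambda>e. butlast (butlast e)"] arg_cong[OF eq, of last]
      by (simp_all add: butlast_append)
    ultimately show "a = b" by (metis append_butlast_last_id)
  qed
  ultimately show ?thesis
    by (simp add: card_Un_disjoint finite_bounded_ge_gt card_snoc_image)
qed

lemma card_bounded_ge_gt_0: "card (bounded_ge_gt n 0) = 1"
proof -
  have "bounded_ge_gt n 0 = {replicate n 0}"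
  proof (intro equalityI subsetI)
    fix e assume "e \<in> bounded_ge_gt n 0"
    then show "e \<in> {replicate n 0}"
      by (auto simp: bounded_ge_gt_def intro!: replicate_eqI dest: length_ge_gt)
  qed (auto simp: bounded_ge_gt_def inv_seqs_ge_gt_def inv_seqs_def)
  then show ?thesis by simp
qed

section \<open>The binomial transform\<close>

text \<open>An entry above \<open>k\<close> could stand only at an index of at least
  \<open>k + 1 + j\<close>, which is already the length.\<close>

lemma shifted_ge_gt_0: "shifted_ge_gt k 0 j = bounded_ge_gt (k + 1 + j) k"
proof (intro equalityI subsetI)
  fix e assume e: "e \<in> shifted_ge_gt k 0 j"
  then have len: "length e = k + 1 + j" by (auto simp: shifted_ge_gt_def dest: length_ge_gt)
  have "e ! i \<le> k" if "i < length e" for i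
  proof (rule ccontr)
    assume "\<not> e ! i \<le> k"
    with e that have "e ! i + j \<le> i" by (simp add: shifted_ge_gt_def)
    with that len \<open>\<not> e ! i \<le> k\<close> show False by simp
  qed
  with e show "e \<in> bounded_ge_gt (k + 1 + j) k"
    by (auto simp: shifted_ge_gt_def bounded_ge_gt_def in_set_conv_nth)
next
  fix e assume "e \<in> bounded_ge_gt (k + 1 + j) k"
  then show "e \<in> shifted_ge_gt k 0 j"
    by (force simp: shifted_ge_gt_def bounded_ge_gt_def dest: nth_mem intro: incr_above_trivial)
qed

text \<open>Pascal's rule: a last entry equal to its maximal value \<open>k + 1 + r\<close> can be removed; if the
  last entry is smaller, strict increase pushes every entry above \<open>k\<close> one further unit below its
  bound.\<close>

lemma card_shifted_ge_gt_Suc: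
  "card (shifted_ge_gt k (Suc r) j) = card (shifted_ge_gt k r j) + card (shifted_ge_gt k r (Suc j))"
proof -
  let ?n = "k + 1 + j + r"
  let ?A = "(\<lambda>e. e @ [k + 1 + r]) ` shifted_ge_gt k r j"
  let ?B = "shifted_ge_gt k r (Suc j)"
  have "shifted_ge_gt k (Suc r) j = ?A \<union> ?B"
  proof (intro equalityI subsetI)
    fix e assume e: "e \<in> shifted_ge_gt k (Suc r) j"
    then have len: "length e = Suc ?n" by (auto simp: shifted_ge_gt_def dest: length_ge_gt)
    have bd: "e ! i + j \<le> i" if "i \<le> ?n" "k < e ! i" for i
      using e len that by (simp add: shifted_ge_gt_def)
    show "e \<in> ?A \<union> ?B"
    proof (cases "e ! ?n = k + 1 + r")
      case True
      obtain x v where xv: "e = x @ [v]" "length x = ?n" using len by (rule snoc_cases_length)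
      with True have "v = k + 1 + r" by (metis nth_append_length)
      moreover have "x ! i + j \<le> i" if "i < ?n" "k < x ! i" for i
        using bd[of i] that xv by (simp add: nth_append)
      ultimately have "x \<in> shifted_ge_gt k r j"
        using e xv by (auto simp: shifted_ge_gt_def ge_gt_snoc incr_above_snoc)
      with xv \<open>v = k + 1 + r\<close> show ?thesis by blast
    next
      case False
      have "e ! i + Suc j \<le> i" if "i < length e" "k < e ! i" for i
      proof -
        have gap: "e ! i + (?n - i) \<le> e ! ?n"
          using incr_above_gap[of k e i ?n] e that len by (simp add: shifted_ge_gt_def)
        with that have "e ! ?n + j \<le> ?n" by (intro bd) auto
        with gap False that len show ?thesis by simp
      qed
      with e show ?thesis by (simp add: shifted_ge_gt_def)
    qed
  next
    fix e assume "e \<in> ?A \<union> ?B"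
    then show "e \<in> shifted_ge_gt k (Suc r) j"
    proof
      assume "e \<in> ?A"
      then obtain x where x: "x \<in> shifted_ge_gt k r j" "e = x @ [k + 1 + r]" by blast
      then have len: "length x = ?n" by (auto simp: shifted_ge_gt_def dest: length_ge_gt)
      have "z < k + 1 + r" if "z \<in> set x" "k < z" for z
      proof -
        from that obtain i where "i < ?n" "x ! i = z" using len by (auto simp: in_set_conv_nth)
        with x that len have "z + j \<le> i" by (auto simp: shifted_ge_gt_def)
        with \<open>i < ?n\<close> show ?thesis by simp
      qed
      with x len show ?thesis
        by (auto simp: shifted_ge_gt_def ge_gt_snoc incr_above_snoc nth_append less_Suc_eq
            intro: incr_above_mono[of k])
    next
      assume "e \<in> ?B"
      then show ?thesis by (fastforce simp: shifted_ge_gt_def)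
    qed
  qed
  moreover have "?A \<inter> ?B = {}"
  proof -
    have False if x: "x \<in> shifted_ge_gt k r j" and B: "x @ [k + 1 + r] \<in> ?B" for x
    proof -
      have len: "length x = ?n" using x by (auto simp: shifted_ge_gt_def dest: length_ge_gt)
      \<comment> \<open>With slack \<open>Suc j\<close>, the entry at index \<open>?n\<close> is at
        most \<open>k + r\<close> if it exceeds \<open>k\<close>.\<close>
      have "(x @ [k + 1 + r]) ! ?n = k + 1 + r" using len by (simp add: nth_append)
      with B len show False by (auto simp: shifted_ge_gt_def dest: spec[of _ ?n])
    qed
    then show ?thesis by blast
  qed
  ultimately show ?thesis
    by (simp add: card_Un_disjoint finite_shifted_ge_gt card_snoc_image)
qed

lemma card_shifted_ge_gt_base: "card (shifted_ge_gt 0 r j) = 2 ^ r"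
  by (induction r arbitrary: j)
    (simp_all add: shifted_ge_gt_0 card_bounded_ge_gt_0 card_shifted_ge_gt_Suc)

text \<open>For \<open>r = 0\<close> this is the recurrence of \<open>bounded_ge_gt\<close>.
  Pascal's rule is linear and shifts only the slack, so it carries the identity from
  \<open>r\<close> to \<open>Suc r\<close>.\<close>

lemma card_shifted_ge_gt_rec:
  "card (shifted_ge_gt (Suc k) r (Suc j)) = card (shifted_ge_gt (Suc k) r j)
     + card (shifted_ge_gt k r (Suc j)) + card (shifted_ge_gt k r (Suc (Suc j)))"
proof (induction r arbitrary: j)
  case 0
  show ?case
    using card_bounded_ge_gt_Suc[of k "k + 2 + j"] by (simp add: shifted_ge_gt_0)
qed (simp add: card_shifted_ge_gt_Suc)

section \<open>Recurrence for 021-avoiders and comparison of the two sides\<close>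

lemma card_bounded_021_0: "card (bounded_021 n 0) = 1"
proof -
  have "bounded_021 n 0 = {replicate n 0}"
  proof (intro equalityI subsetI)
    fix e assume "e \<in> bounded_021 n 0"
    then show "e \<in> {replicate n 0}"
      by (auto simp: bounded_021_def intro!: replicate_eqI dest: length_021)
  qed (auto simp: bounded_021_def inv_seqs_021_def inv_seqs_def)
  then show ?thesis by simp
qed

text \<open>Either \<open>Suc m\<close> is absent, or it is last, or it occurs earlier and the last
  entry must be 0. The third class is a difference of two counts, moved to the left to avoid
  subtraction.\<close>

lemma card_bounded_021_Suc:
  assumes "m < n"
  shows "card (bounded_021 (Suc n) (Suc m)) + card (bounded_021 n m)
     = card (bounded_021 (Suc n) m) + 2 * card (bounded_021 n (Suc m))"
proof -
  let ?A = "bounded_021 (Suc n) m"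
  let ?B = "(\<lambda>e. e @ [Suc m]) ` bounded_021 n (Suc m)"
  let ?C = "(\<lambda>e. e @ [0]) ` (bounded_021 n (Suc m) - bounded_021 n m)"
  have "bounded_021 (Suc n) (Suc m) = ?A \<union> (?B \<union> ?C)"
  proof (intro equalityI subsetI)
    fix e assume e: "e \<in> bounded_021 (Suc n) (Suc m)"
    then have "length e = Suc n" by (simp add: bounded_021_def length_021)
    then obtain x v where [simp]: "e = x @ [v]" by (rule snoc_cases_length)
    have x: "x \<in> bounded_021 n (Suc m)" "v \<le> Suc m" "v = 0 \<or> (\<forall>z\<in>set x. z \<le> v)"
      using e by (auto simp: bounded_021_def inv_seqs_021_snoc)
    consider "v = Suc m" | "v \<le> m" "x \<in> bounded_021 n m" | "v \<le> m" "x \<notin> bounded_021 n m"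
      using x by linarith
    then show "e \<in> ?A \<union> (?B \<union> ?C)"
    proof cases
      case 3
      with x have "v = 0" by (force simp: bounded_021_def)
      with 3 x show ?thesis by simp
    qed (use x e in \<open>auto simp: bounded_021_def\<close>)
  qed (use assms in \<open>auto simp: bounded_021_def inv_seqs_021_snoc\<close>)
  moreover have "?A \<inter> (?B \<union> ?C) = {}"
    by (auto simp: bounded_021_def inv_seqs_021_snoc)
  moreover have "?B \<inter> ?C = {}" by auto
  moreover have "bounded_021 n m \<subseteq> bounded_021 n (Suc m)"
    by (auto simp: bounded_021_def)
  ultimately show ?thesis
    using card_mono[OF finite_bounded_021 \<open>bounded_021 n m \<subseteq> bounded_021 n (Suc m)\<close>]
    by (simp add: card_Un_disjoint finite_bounded_021 card_snoc_image card_Diff_subset)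
qed

text \<open>Both arrays obey the same recurrence in \<open>k\<close> and \<open>r\<close>, so
  agreement at \<open>k = 0\<close> and at \<open>r = 0\<close> suffices.\<close>

lemma card_shifted_ge_gt_eq_021:
  "card (shifted_ge_gt k r 0) = card (bounded_021 (Suc (k + r)) (Suc k))"
proof (induction k arbitrary: r)
  case 0
  have "card (bounded_021 (Suc r) (Suc 0)) = 2 ^ r"
  proof (induction r)
    case 0
    show ?case
      using card_bounded_021_0[of "Suc 0"] by (simp add: bounded_021_beyond)
  next
    case (Suc r)
    then show ?case
      using card_bounded_021_Suc[of 0 "Suc r"] by (simp add: card_bounded_021_0)
  qed
  then show ?case by (simp add: card_shifted_ge_gt_base)
next
  case (Suc k)
  note IH = Suc.IH
  show ?case
  proof (induction r)
    case 0
    \<comment> \<open>The diagonal recurrence has the shape of Pascal's rule for \<open>k\<close>.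
      On the 021 side, the length \<open>k + 2\<close> makes the bounds \<open>k + 1\<close> and
      \<open>k + 2\<close> equally vacuous.\<close>
    have "card (shifted_ge_gt (Suc k) 0 0) = card (shifted_ge_gt k (Suc 0) 0)"
      using card_bounded_ge_gt_diag[of k]
      by (simp add: shifted_ge_gt_0 card_shifted_ge_gt_Suc)
    then show ?case using IH[of "Suc 0"] by (simp add: bounded_021_beyond)
  next
    case (Suc r)
    \<comment> \<open>Expanding by Pascal's rule down to parameter \<open>r\<close> eliminates all
      terms with positive slack and leaves the recurrence of \<open>bounded_021\<close>.\<close>
    have "card (shifted_ge_gt (Suc k) (Suc r) 0) + card (shifted_ge_gt k (Suc r) 0)
      = card (shifted_ge_gt k (Suc (Suc r)) 0) + 2 * card (shifted_ge_gt (Suc k) r 0)"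
      using card_shifted_ge_gt_rec[of k r 0] by (simp add: card_shifted_ge_gt_Suc)
    then show ?case
      using card_bounded_021_Suc[of "Suc k" "Suc (Suc (k + r))"] IH[of "Suc r"]
        IH[of "Suc (Suc r)"] Suc.IH by simp
  qed
qed

text \<open>For \<open>k < n\<close> this is the case of slack 0, whose bound is the inversion bound
  itself. For \<open>k = n\<close> both restrictions are vacuous.\<close>

lemma card_incr_above_eq_021:
  assumes "k \<le> n"
  shows "card {e \<in> inv_seqs_ge_gt n. incr_above k e} = card (bounded_021 n (Suc k))"
proof -
  have main: "card {e \<in> inv_seqs_ge_gt n. incr_above k e} = card (bounded_021 n (Suc k))"
    if "k < n" for k n
  proof -
    from that obtain r where n: "n = Suc (k + r)" by (auto simp: less_iff_Suc_add)
    have "{e \<in> inv_seqs_ge_gt n. incr_above k e} = shifted_ge_gt k r 0"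
      unfolding shifted_ge_gt_def n using nth_ge_gt by (fastforce simp: length_ge_gt)
    then show ?thesis using n by (simp add: card_shifted_ge_gt_eq_021)
  qed
  have all: "{e \<in> inv_seqs_ge_gt n. incr_above l e} = inv_seqs_ge_gt n" if "n \<le> Suc l" for l
    using that by (force intro!: incr_above_trivial dest: set_ge_gt)
  show ?thesis
  proof (cases "k < n")
    case False
    with assms have [simp]: "k = n" by simp
    show ?thesis
    proof (cases n)
      case 0
      then show ?thesis
        using all[of 0] by (simp add: bounded_021_beyond ge_gt_0 inv_seqs_021_0)
    next
      case (Suc l)
      then show ?thesis using main[of l n] all[of l] all[of n] by (simp add: bounded_021_beyond)
    qed
  qed (rule main)
qed

theorem theorem3p1:
  fixes n k :: nat
  assumes "n \<ge> 1" and "k \<le> n - 1"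
  shows "card {e \<in> inv_seqs_ge_gt n. e ! (n - 1) = k}
       = card {e \<in> inv_seqs_021 n. [e ! (n - 1) = k + 1] (mod n)}"
proof -
  obtain m where n: "n = Suc m" using assms by (cases n) auto
  with assms have k: "k \<le> m" by simp
  have "{e \<in> inv_seqs_ge_gt n. e ! (n - 1) = k}
      = (\<lambda>e. e @ [k]) ` {e \<in> inv_seqs_ge_gt m. incr_above k e}" (is "?L = ?R")
  proof (intro equalityI subsetI)
    fix e assume e: "e \<in> ?L"
    then have "length e = Suc m" by (simp add: n length_ge_gt)
    then obtain x v where "e = x @ [v]" "length x = m" by (rule snoc_cases_length)
    with e show "e \<in> ?R" by (auto simp: n ge_gt_snoc)
  next
    fix e assume "e \<in> ?R"
    with k show "e \<in> ?L" by (auto simp: n ge_gt_snoc nth_append dest: length_ge_gt)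
  qed
  \<comment> \<open>The last entry is the residue of \<open>k + 1\<close>. If \<open>k = m\<close>
    it is 0 and leaves the prefix free, in accordance with the vacuous bound
    \<open>Suc k\<close>.\<close>
  moreover have "{e \<in> inv_seqs_021 n. [e ! (n - 1) = k + 1] (mod n)}
      = (\<lambda>e. e @ [(k + 1) mod n]) ` bounded_021 m (Suc k)" (is "?L' = ?R'")
  proof (intro equalityI subsetI)
    fix e assume e: "e \<in> ?L'"
    then have "length e = Suc m" by (simp add: n length_021)
    then obtain x v where xv: "e = x @ [v]" "length x = m" by (rule snoc_cases_length)
    with e have x: "x \<in> inv_seqs_021 m" "v \<le> m" "v = 0 \<or> (\<forall>z\<in>set x. z \<le> v)"
      by (auto simp: n inv_seqs_021_snoc)
    have "e ! m = v" using xv by (metis nth_append_length)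
    with e have v: "v = (k + 1) mod n" using x(2) by (simp add: n cong_def)
    have "x \<in> bounded_021 m (Suc k)"
    proof (cases "k = m")
      case True
      with x show ?thesis by (simp add: bounded_021_beyond)
    next
      case False
      with k v x show ?thesis by (simp add: n bounded_021_def)
    qed
    with xv v show "e \<in> ?R'" by simp
  next
    fix e assume "e \<in> ?R'"
    then obtain x where x: "x \<in> bounded_021 m (Suc k)" "e = x @ [(k + 1) mod n]" by blast
    then have "length x = m" by (auto simp: bounded_021_def dest: length_021)
    with x k show "e \<in> ?L'"
      by (cases "k = m") (auto simp: n bounded_021_def inv_seqs_021_snoc cong_def nth_append)
  qed
  ultimately show ?thesis
    using card_incr_above_eq_021[OF k] by (simp add: card_snoc_image)
qed

end
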